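(* Let $n\ge 2$ be an integer and let $a,b,c>0$ be real numbers with $a+b+c=\frac{\tau}{2n}$, where $\tau=2\pi$. Write $x^{(k)}=x+k\frac{\tau}{2n}$. Let $ABC$ be a Euclidean triangle in the plane, with vertices $A,B,C$ in counter-clockwise order and with angles $na,nb,nc$ at $A,B,C$ respectively. Then the Conway $n$-doughnut with parameters $a,b,c$ exists in $ABC$. That is, there are points $P_0,\dots,P_n$, $Q_0,\dots,Q_n$, $R_0,\dots,R_n$ in the closed triangle $ABC$ with $$P_0=B,\ P_n=C,\qquad Q_0=C,\ Q_n=A,\qquad R_0=A,\ R_n=B,$$ $$P_1=Q_{n-1},\qquad Q_1=R_{n-1},\qquad R_1=P_{n-1},$$ such that: (1) For each $k=0,1,\dots,n-1$, the following triangles are nondegenerate, have their vertices listed in counter-clockwise order, and have the following angles at the listed vertices, in the listed order: $$AP_kP_{k+1}\ \text{has angles}\ \left(a,\ b^{(k)},\ c^{(n-1-k)}\right),$$ $$BQ_kQ_{k+1}\ \text{has angles}\ \left(b,\ c^{(k)},\ a^{(n-1-k)}\right),$$ $$CR_kR_{k+1}\ \text{has angles}\ \left(c,\ a^{(k)},\ b^{(n-1-k)}\right).$$ (2) If $n\ge 3$, the triangles with vertex sets $\{P_1,P_2,Q_{n-2}\}$, $\{Q_1,Q_2,R_{n-2}\}$, $\{R_1,R_2,P_{n-2}\}$ are isosceles, with apexes $P_1$, $Q_1$, $R_1$ respectively, apex angle $\frac{n-2}{2n}\tau$ and both base angles $\frac{\tau}{2n}$. (3) The triangles of (1) and (2),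 where triangles with the same vertex set are counted once, have pairwise disjoint interiors.
   Context: $\tau=2\pi$ denotes a full turn, so the angles of a Euclidean triangle sum to $\tau/2$. A diagram is said to exist if triangles of the designated shapes (similarity classes, with angles in counter-clockwise order) fit together in the designated pattern. In the Conway $n$-doughnut, the triangles $AP_kP_{k+1}$ form a fan of $n$ triangles at corner $A$, each with angle $a$ at $A$, and similarly at $B$ and $C$. Neighbouring fans share the triangle on the common side: $ABP_1$, with $P_1=Q_{n-1}$, belongs to the fans at $A$ and $B$; $BCQ_1$, with $Q_1=R_{n-1}$, to the fans at $B$ and $C$; and $CAR_1$, with $R_1=P_{n-1}$, to the fans at $C$ and $A$. The isosceles triangles are attached at the three shared points $P_1,Q_1,R_1$, on the side of the hole. For $n=3$ the three isosceles triangles are one and the same equilateral triangle; for $n=2$ there are none, and the three shared points coincide. No requirement is made on any remaining part of the hole. *)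

theory Defs
  imports "HOL-Analysis.Analysis"
begin

text \<open>The Euclidean plane is \<^typ>\<open>complex\<close>.\<close>

definition tau :: real (\<open>\<tau>\<close>)
  where "\<tau> = 2 * pi"

text \<open>Unsigned angle \<open>XYZ\<close> at the vertex \<open>Y\<close>. It is only used for nondegenerate triangles,
  so the value for \<open>X = Y\<close> or \<open>Z = Y\<close> is irrelevant.\<close>

definition angle :: "complex \<Rightarrow> complex \<Rightarrow> complex \<Rightarrow> real"
  where "angle X Y Z = arccos (((X - Y) \<bullet> (Z - Y)) / (norm (X - Y) * norm (Z - Y)))"

text \<open>The imaginary part below is twice the signed area of \<open>XYZ\<close>; its being positive says
  that the triangle is nondegenerate and that \<open>X, Y, Z\<close> are in counter-clockwise order.\<close>

definition ccw_triangle :: "complex \<Rightarrow> complex \<Rightarrow> complex \<Rightarrow> bool"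
  where "ccw_triangle X Y Z \<longleftrightarrow> Im (cnj (Y - X) * (Z - X)) > 0"

definition has_angles ::
    "complex \<Rightarrow> complex \<Rightarrow> complex \<Rightarrow> real \<Rightarrow> real \<Rightarrow> real \<Rightarrow> bool"
  where "has_angles X Y Z \<alpha> \<beta> \<gamma> \<longleftrightarrow>
    angle Y X Z = \<alpha> \<and> angle Z Y X = \<beta> \<and> angle X Z Y = \<gamma>"

text \<open>\<open>shift n x k\<close> is written $x^{(k)}$ in the usual notation.\<close>

definition shift :: "nat \<Rightarrow> real \<Rightarrow> nat \<Rightarrow> real"
  where "shift n x k = x + real k * (\<tau> / (2 * real n))"

text \<open>The fan of \<open>n\<close> triangles at the corner \<open>V\<close>; the parameter \<open>a\<close> belongs to that corner,
  and \<open>b, c\<close> to the following two corners in counter-clockwise order.\<close>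

definition fan ::
    "nat \<Rightarrow> real \<Rightarrow> real \<Rightarrow> real \<Rightarrow> complex \<Rightarrow> (nat \<Rightarrow> complex) \<Rightarrow> bool"
  where "fan n a b c V P \<longleftrightarrow>
    (\<forall>k<n. ccw_triangle V (P k) (P (k + 1)) \<and>
           has_angles V (P k) (P (k + 1)) a (shift n b k) (shift n c (n - 1 - k)))"

text \<open>The isosceles triangle with apex \<open>X\<close>. No orientation is imposed.\<close>

definition hole_triangle :: "nat \<Rightarrow> complex \<Rightarrow> complex \<Rightarrow> complex \<Rightarrow> bool"
  where "hole_triangle n X Y Z \<longleftrightarrow>
    \<not> collinear {X, Y, Z} \<and> dist X Y = dist X Z \<and>
    has_angles X Y Z ((real n - 2) / (2 * real n) * \<tau>) (\<tau> / (2 * real n)) (\<tau> / (2 * real n))"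

text \<open>Triangles are represented by their vertex sets, so that a shared triangle occurs only
  once in the following sets.\<close>

definition fan_triangles :: "nat \<Rightarrow> complex \<Rightarrow> (nat \<Rightarrow> complex) \<Rightarrow> complex set set"
  where "fan_triangles n V P = {{V, P k, P (k + 1)} | k. k < n}"

definition doughnut_triangles ::
    "nat \<Rightarrow> complex \<Rightarrow> complex \<Rightarrow> complex \<Rightarrow>
     (nat \<Rightarrow> complex) \<Rightarrow> (nat \<Rightarrow> complex) \<Rightarrow> (nat \<Rightarrow> complex) \<Rightarrow> complex set set"
  where "doughnut_triangles n A B C P Q R =
    fan_triangles n A P \<union> fan_triangles n B Q \<union> fan_triangles n C R \<union>
    (if n \<ge> 3
     then {{P 1, P 2, Q (n - 2)}, {Q 1, Q 2, R (n - 2)}, {R 1, R 2, P (n - 2)}}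
     else {})"

text \<open>Only the values of \<open>P, Q, R\<close> on \<open>{0..n}\<close> matter.\<close>

definition conway_doughnut ::
    "nat \<Rightarrow> real \<Rightarrow> real \<Rightarrow> real \<Rightarrow> complex \<Rightarrow> complex \<Rightarrow> complex \<Rightarrow>
     (nat \<Rightarrow> complex) \<Rightarrow> (nat \<Rightarrow> complex) \<Rightarrow> (nat \<Rightarrow> complex) \<Rightarrow> bool"
  where "conway_doughnut n a b c A B C P Q R \<longleftrightarrow>
    (\<forall>k\<le>n. P k \<in> convex hull {A, B, C} \<and> Q k \<in> convex hull {A, B, C} \<and>
           R k \<in> convex hull {A, B, C}) \<and>
    P 0 = B \<and> P n = C \<and> Q 0 = C \<and> Q n = A \<and> R 0 = A \<and> R n = B \<and>
    P 1 = Q (n - 1) \<and> Q 1 = R (n - 1) \<and> R 1 = P (n - 1) \<and>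
    fan n a b c A P \<and> fan n b c a B Q \<and> fan n c a b C R \<and>
    (n \<ge> 3 \<longrightarrow>
       hole_triangle n (P 1) (P 2) (Q (n - 2)) \<and>
       hole_triangle n (Q 1) (Q 2) (R (n - 2)) \<and>
       hole_triangle n (R 1) (R 2) (P (n - 2))) \<and>
    pairwise (\<lambda>S T. disjnt (interior (convex hull S)) (interior (convex hull T)))
      (doughnut_triangles n A B C P Q R)"

end

theory Submission
  imports Defs
begin

text \<open>Write \<open>\<delta> = pi / n = a + b + c\<close> and, for an angle \<open>x\<close>, let \<open>S x k\<close> (formally \<open>sin_prod n x k\<close>) be the product
  of the sines of \<open>x\<close>, \<open>x + \<delta>\<close>, \<dots>, \<open>x + (k - 1) \<delta>\<close>.

  \<^emph>\<open>Existence.\<close> The law of sines in the triangles of the fan at \<open>A\<close> leaves one candidate: the point \<open>P k\<close>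
  in the direction that makes the angle \<open>k a\<close> with the side \<open>A B\<close>, at a distance from \<open>A\<close> proportional
  to \<open>S b k * S c (n - k)\<close>. The last point is \<open>C\<close> because of the product formula
  \<open>2 ^ n * S x n = 2 * sin (n * x)\<close> (\<open>sin_prod_full\<close>) and the law of sines in \<open>A B C\<close>. One scale serves all
  three corners, and then neighbouring fans agree on their common triangle (\<open>P_1\<close>). An edge
  of the chain \<open>P\<close> has length \<open>sin a * S b k * S c (n - 1 - k)\<close> and direction \<open>pi - b - k (b + c)\<close> relative to
  the side \<open>A B\<close> (\<open>P_edge\<close>). The angles of the fan are differences of directions. The legs of the
  isosceles triangle at \<open>P 1\<close> have equal length because the formula for \<open>k = 1\<close> is symmetric
  in \<open>a\<close> and \<open>b\<close>.

  \<^emph>\<open>Disjointness.\<close> Each chain turns right at each of its vertices, by \<open>b + c\<close> in the case of \<open>P\<close>, and the three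
  chains together bound a convex hole. Any two of the triangles are separated by a line: two
  triangles of one fan by a ray from the corner, triangles of the fans at \<open>A\<close> and \<open>B\<close> by the
  line from \<open>P 1\<close> to \<open>C\<close>, a fan triangle and an isosceles triangle by a line along a side of the fan
  triangle, two isosceles triangles by a line along the base of one of them. Whether a point lies
  on the correct side of such a line is mostly decided by walking to it along a chain: the
  signed distance from the line increases or decreases with the sign of the sine of a difference of
  directions. Where it does both, it first increases and then decreases, so that it is bounded below by
  its values at the ends of the chain (\<open>chain_quasiconcave\<close>), and these ends are
  points where two chains meet.\<close>

section \<open>Products of sines\<close>

text \<open>Both sides are monic polynomials of degree \<open>n\<close> in \<open>x\<close> with the \<open>n\<close> roots of unity as zeros.\<close>
lemma prod_diff_roots_of_unity:
  fixes x :: complex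
  assumes "n > 0"
  shows "(\<Prod>k<n. x - cis (2 * pi * real k / real n)) = x ^ n - 1"
proof -
  let ?R = "{z::complex. z ^ n = 1}"
  have fin: "finite ?R" and card: "card ?R = n"
    using assms by (simp_all add: finite_roots_unity card_roots_unity_eq)
  let ?p = "\<Prod>z\<in>?R. [:-z, 1:]"
  have "?p = monom 1 n - 1"
  proof (rule poly_eqI_degree_lead_coeff[where n = n and A = ?R])
    have deg: "degree ?p = n"
      using card by (subst degree_prod_eq_sum_degree) auto
    moreover have "lead_coeff ?p = 1"
      by (simp add: lead_coeff_prod)
    ultimately show "poly.coeff ?p n = poly.coeff (monom 1 n - 1) n"
      using assms by simp
    show "degree ?p \<le> n" using deg by simp
    show "degree (monom 1 n - 1 :: complex poly) \<le> n"
      by (rule degree_diff_le) (auto simp: degree_monom_eq)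
    show "poly ?p z = poly (monom 1 n - 1) z" if "z \<in> ?R" for z
      using that fin by (auto simp: poly_prod poly_monom)
  qed (use card in auto)
  then have "poly ?p x = x ^ n - 1"
    by (simp add: poly_monom)
  then have "(\<Prod>z\<in>?R. x - z) = x ^ n - 1"
    by (simp add: poly_prod)
  moreover have "(\<Prod>k<n. x - cis (2 * pi * real k / real n)) = (\<Prod>z\<in>?R. x - z)"
    using prod.reindex_bij_betw[OF Complex.bij_betw_roots_unity[OF assms], of "\<lambda>z. x - z"] .
  ultimately show ?thesis by simp
qed

lemma norm_cis_diff: "norm (cis s - cis t) = 2 * \<bar>sin ((s - t) / 2)\<bar>"
proof -
  have "cis s - cis t = 2 * sin ((s - t) / 2) * \<i> * cis ((s + t) / 2)"
    using sin_minus[of "(s - t) / 2"]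
    by (simp add: complex_eq_iff sin_diff_sin cos_diff_cos minus_divide_left del: sin_minus)
  then show ?thesis by (simp add: norm_mult)
qed

definition sin_prod :: "nat \<Rightarrow> real \<Rightarrow> nat \<Rightarrow> real"
  where "sin_prod n x k = (\<Prod>j<k. sin (shift n x j))"

lemma sin_prod_0 [simp]: "sin_prod n x 0 = 1"
  by (simp add: sin_prod_def)

lemma sin_prod_1 [simp]: "sin_prod n x (Suc 0) = sin x"
  by (simp add: sin_prod_def shift_def)

lemma sin_prod_Suc: "sin_prod n x (Suc k) = sin_prod n x k * sin (shift n x k)"
  by (simp add: sin_prod_def)

lemma sin_shift_pos:
  assumes "n > 0" "0 < x" "x < pi / real n" "j < n"
  shows "sin (shift n x j) > 0"
proof (rule sin_gt_zero)
  show "0 < shift n x j" using assms by (simp add: shift_def tau_def add_pos_nonneg)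
  have "shift n x j < (real j + 1) * (pi / real n)"
    using assms by (simp add: shift_def tau_def field_simps)
  also have "\<dots> \<le> real n * (pi / real n)"
    using assms by (intro mult_right_mono) auto
  finally show "shift n x j < pi" using assms by simp
qed

lemma sin_prod_pos:
  assumes "n > 0" "0 < x" "x < pi / real n" "k \<le> n"
  shows "sin_prod n x k > 0"
  unfolding sin_prod_def using assms by (intro prod_pos) (auto intro: sin_shift_pos)

text \<open>The product formula for the sine. It makes the last point of a fan land on the next
  corner: the ratio of two sides, a quotient of two such products, becomes the ratio
  of \<open>sin (n b)\<close> and \<open>sin (n c)\<close> that the law of sines demands.\<close>
lemma sin_prod_full:
  assumes "n > 0" "0 < x" "x < pi / real n"
  shows "2 ^ n * sin_prod n x n = 2 * sin (real n * x)"
proof -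
  \<comment> \<open>A factor of the product at \<open>cis (- 2 x)\<close> is a chord of the unit circle, of length \<open>2 sin (x + k pi / n)\<close>.\<close>
  have "2 * \<bar>sin (real n * x)\<bar> = norm (cis (- 2 * x) ^ n - 1)"
    using norm_cis_diff[of "real n * (- 2 * x)" 0] unfolding Complex.DeMoivre by simp
  also have "\<dots> = (\<Prod>k<n. norm (cis (- 2 * x) - cis (2 * pi * real k / real n)))"
    unfolding prod_diff_roots_of_unity[OF \<open>n > 0\<close>, symmetric] by (rule prod_norm[symmetric])
  also have "\<dots> = (\<Prod>k<n. 2 * sin (shift n x k))"
  proof (rule prod.cong)
    fix k assume "k \<in> {..<n}"
    then have "sin (shift n x k) > 0" using assms by (auto intro: sin_shift_pos)
    moreover have "(- 2 * x - 2 * pi * real k / real n) / 2 = - shift n x k"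
      using assms by (simp add: shift_def tau_def field_simps)
    ultimately show "norm (cis (- 2 * x) - cis (2 * pi * real k / real n)) = 2 * sin (shift n x k)"
      by (simp add: norm_cis_diff)
  qed simp
  also have "\<dots> = 2 ^ n * sin_prod n x n"
    by (simp add: sin_prod_def prod.distrib)
  finally show ?thesis
    using assms sin_gt_zero[of "real n * x"] by (simp add: field_simps)
qed

section \<open>Sides of a line and angles\<close>

text \<open>The cross product of \<open>d\<close> and \<open>p\<close>. For a point \<open>x\<close>, the points \<open>p\<close> with \<open>side d p \<ge> side d x\<close>
  are those to the left of, or on, the line through \<open>x\<close> with direction \<open>d\<close>.\<close>
definition side :: "complex \<Rightarrow> complex \<Rightarrow> real"
  where "side d p = Im (cnj d * p)"

lemma side_diff: "side d (p - q) = side d p - side d q"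
  by (simp add: side_def algebra_simps)

lemma side_scale: "side (of_real r * d) p = r * side d p"
  by (simp add: side_def algebra_simps)

lemma cnj_cis_mult_cis:
  "cnj (cis s * u) * (cis t * u) = of_real ((norm u)\<^sup>2) * cis (t - s)"
proof -
  have "cis (t - s) = cnj (cis s) * cis t" by (simp add: cis_cnj cis_mult)
  then show ?thesis by (simp add: complex_norm_square mult_ac del: of_real_power)
qed

text \<open>Directions are always measured against a fixed nonzero vector \<open>u\<close>. The sign of a cross product
  is then the sign of the sine of a difference of directions.\<close>
lemma side_cis: "side (cis s * u) (of_real r * (cis t * u)) = r * ((norm u)\<^sup>2 * sin (t - s))"
proof -
  have "side (cis s * u) (of_real r * (cis t * u)) = Im (of_real r * (cnj (cis s * u) * (cis t * u)))"
    by (simp only: side_def mult_ac)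
  then show ?thesis unfolding cnj_cis_mult_cis by simp
qed

lemma not_collinear_if_side:
  assumes "side (Z - X) (Y - X) \<noteq> 0"
  shows "\<not> collinear {X, Y, Z}"
proof
  assume "collinear {X, Y, Z}"
  moreover have "{X, Y, Z} = {Y, X, Z}" by blast
  ultimately have "collinear {0, Y - X, Z - X}"
    using collinear_3[of Y X Z] by (simp add: NO_MATCH_def)
  then consider "Y - X = 0" | "Z - X = 0" | t where "Z - X = t *\<^sub>R (Y - X)"
    unfolding collinear_lemma by blast
  then have "side (Z - X) (Y - X) = 0"
    by cases (simp_all add: side_def, simp add: algebra_simps)
  then show False using assms by contradiction
qed

text \<open>The barycentric coordinates of \<open>p\<close> are the signed areas cut off by \<open>p\<close> at the three sides,
  divided by the area of the whole triangle.\<close>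
lemma in_triangle_if_left_of_sides:
  assumes ccw: "ccw_triangle A B C"
    and "side (B - A) (p - A) \<ge> 0" "side (C - B) (p - B) \<ge> 0" "side (A - C) (p - C) \<ge> 0"
  shows "p \<in> convex hull {A, B, C}"
proof -
  define D where "D = side (B - A) (C - A)"
  have D: "D > 0" using ccw by (simp add: D_def ccw_triangle_def side_def)
  define \<alpha> \<beta> \<gamma> where "\<alpha> = side (C - B) (p - B) / D" and "\<beta> = side (A - C) (p - C) / D"
    and "\<gamma> = side (B - A) (p - A) / D"
  have sum: "\<alpha> + \<beta> + \<gamma> = 1"
    using D by (simp add: \<alpha>_def \<beta>_def \<gamma>_def flip: add_divide_distrib)
       (simp add: D_def side_def algebra_simps)
  have "D *\<^sub>R p = (D * \<alpha>) *\<^sub>R A + (D * \<beta>) *\<^sub>R B + (D * \<gamma>) *\<^sub>R C"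
    using D unfolding \<alpha>_def \<beta>_def \<gamma>_def
    by (simp add: complex_eq_iff) (simp add: D_def side_def algebra_simps)
  then have "D *\<^sub>R p = D *\<^sub>R (\<alpha> *\<^sub>R A + \<beta> *\<^sub>R B + \<gamma> *\<^sub>R C)"
    by (simp add: scaleR_add_right)
  then have "p = \<alpha> *\<^sub>R A + \<beta> *\<^sub>R B + \<gamma> *\<^sub>R C"
    using D by (metis less_irrefl real_vector.scale_left_imp_eq)
  moreover have "\<alpha> \<ge> 0" "\<beta> \<ge> 0" "\<gamma> \<ge> 0"
    using assms D by (simp_all add: \<alpha>_def \<beta>_def \<gamma>_def)
  ultimately show ?thesis using sum by (auto simp: convex_hull_3)
qed

definition disjoint_triangles :: "complex set \<Rightarrow> complex set \<Rightarrow> bool"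
  where "disjoint_triangles S T \<longleftrightarrow> disjnt (interior (convex hull S)) (interior (convex hull T))"

lemma disjoint_triangles_sym: "disjoint_triangles S T \<Longrightarrow> disjoint_triangles T S"
  by (simp add: disjoint_triangles_def disjnt_sym)

text \<open>Both hulls lie in opposite closed half-planes of one line, so their interiors lie in the
  disjoint open half-planes.\<close>
lemma disjoint_triangles_separated:
  assumes "d \<noteq> 0" and S: "\<And>p. p \<in> S \<Longrightarrow> side d p \<ge> side d x"
    and T: "\<And>p. p \<in> T \<Longrightarrow> side d p \<le> side d x"
  shows "disjoint_triangles S T"
proof -
  have side: "side d p = (\<i> * d) \<bullet> p" for p
    by (simp add: side_def inner_complex_def)
  have nz: "\<i> * d \<noteq> 0" using assms by simp
  have "convex hull S \<subseteq> {p. (\<i> * d) \<bullet> p \<ge> side d x}"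
    using S by (intro hull_minimal) (auto simp: side convex_halfspace_ge)
  then have 1: "interior (convex hull S) \<subseteq> {p. (\<i> * d) \<bullet> p > side d x}"
    using interior_mono interior_halfspace_ge[OF nz] by blast
  have "convex hull T \<subseteq> {p. (\<i> * d) \<bullet> p \<le> side d x}"
    using T by (intro hull_minimal) (auto simp: side convex_halfspace_le)
  then have 2: "interior (convex hull T) \<subseteq> {p. (\<i> * d) \<bullet> p < side d x}"
    using interior_mono interior_halfspace_le[OF nz] by blast
  show ?thesis unfolding disjoint_triangles_def disjnt_def using 1 2 by fastforce
qed

lemma angle_cis:
  assumes "X - Y = of_real p * (cis s * u)" "Z - Y = of_real q * (cis t * u)"
    and "p > 0" "q > 0" "u \<noteq> 0" "0 \<le> t - s" "t - s \<le> pi"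
  shows "angle X Y Z = t - s" "angle Z Y X = t - s"
proof -
  have n: "norm (X - Y) = p * norm u" "norm (Z - Y) = q * norm u"
    using assms by (simp_all add: norm_mult)
  have "(X - Y) \<bullet> (Z - Y) = Re (cnj (X - Y) * (Z - Y))"
    by (simp add: inner_complex_def algebra_simps)
  also have "cnj (X - Y) * (Z - Y) = of_real (p * q) * (cnj (cis s * u) * (cis t * u))"
    unfolding assms(1,2) by (simp add: mult_ac)
  finally have i: "(X - Y) \<bullet> (Z - Y) = p * q * (norm u)\<^sup>2 * cos (t - s)"
    unfolding cnj_cis_mult_cis by simp
  show "angle X Y Z = t - s"
    unfolding angle_def i n using assms by (simp add: power2_eq_square arccos_cos)
  then show "angle Z Y X = t - s"
    by (simp add: angle_def inner_commute mult.commute)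
qed

text \<open>By Cauchy-Schwarz the argument of the arc cosine lies in its domain, so the arc cosine can be inverted.\<close>
lemma inner_if_angle:
  assumes "angle X Y Z = \<alpha>" "X \<noteq> Y" "Z \<noteq> Y"
  shows "(X - Y) \<bullet> (Z - Y) = norm (X - Y) * norm (Z - Y) * cos \<alpha>"
proof -
  let ?q = "((X - Y) \<bullet> (Z - Y)) / (norm (X - Y) * norm (Z - Y))"
  have "\<bar>?q\<bar> \<le> 1"
    using Cauchy_Schwarz_ineq2[of "X - Y" "Z - Y"] assms by (simp add: field_simps)
  then have "cos (arccos ?q) = ?q" by (rule cos_arccos_abs)
  then have "cos \<alpha> = ?q" using assms(1) by (simp add: angle_def)
  then show ?thesis using assms by simp
qed

lemma ccw_angle_polar:
  assumes "ccw_triangle X Y Z" "angle Y X Z = \<alpha>" "0 < \<alpha>" "\<alpha> < pi"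
  shows "\<exists>r>0. Z - X = of_real r * cis \<alpha> * (Y - X)"
proof -
  have side: "side (Y - X) (Z - X) > 0" using assms(1) by (simp add: ccw_triangle_def side_def)
  then have nz: "Y - X \<noteq> 0" "Z - X \<noteq> 0" by (auto simp: side_def)
  define z where "z = (Z - X) / (Y - X)"
  have z: "Z - X = z * (Y - X)" using nz by (simp add: z_def)
  then have "z \<noteq> 0" using nz by auto
  define N where "N = (norm (Y - X))\<^sup>2"
  have N: "N > 0" using nz by (simp add: N_def)
  have NN: "cnj (Y - X) * (z * (Y - X)) = of_real N * z"
    unfolding N_def complex_norm_square by (simp add: mult_ac)
  have "Im z > 0" using side N unfolding side_def z NN by (simp add: zero_less_mult_iff)
  have "(Y - X) \<bullet> (Z - X) = Re (cnj (Y - X) * (Z - X))" by (simp add: inner_complex_def algebra_simps)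
  also have "\<dots> = N * Re z" unfolding z NN by simp
  also have "(Y - X) \<bullet> (Z - X) = norm (Y - X) * norm (Z - X) * cos \<alpha>"
    by (rule inner_if_angle[OF assms(2)]) (use nz assms in auto)
  finally have "N * Re z = N * (norm z * cos \<alpha>)"
    by (auto simp: z norm_mult N_def power2_eq_square)
  then have Re: "Re z = norm z * cos \<alpha>" using N by simp
  \<comment> \<open>The modulus and the real part determine the imaginary part up to sign; orientation fixes the sign.\<close>
  have "(Im z)\<^sup>2 = (norm z)\<^sup>2 - (norm z * cos \<alpha>)\<^sup>2"
    using cmod_power2[of z] Re by simp
  also have "\<dots> = (norm z * sin \<alpha>)\<^sup>2"
    by (simp add: power_mult_distrib sin_squared_eq algebra_simps)
  finally have "Im z = norm z * sin \<alpha>"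
    using \<open>Im z > 0\<close> sin_gt_zero[of \<alpha>] assms by (simp add: power2_eq_iff_nonneg)
  then have "z = of_real (norm z) * cis \<alpha>" using Re by (simp add: complex_eq_iff)
  then show ?thesis using z \<open>z \<noteq> 0\<close> by (metis zero_less_norm_iff)
qed

text \<open>The law of sines, in a form that also records the direction: the angle \<open>\<alpha>\<close> turns the side
  from \<open>A\<close> to \<open>B\<close> into the direction from \<open>A\<close> to \<open>C\<close>.\<close>
lemma law_of_sines:
  assumes "ccw_triangle A B C" "has_angles A B C \<alpha> \<beta> \<gamma>" "0 < \<alpha>" "0 < \<beta>" "0 < \<gamma>" "\<alpha> + \<beta> + \<gamma> = pi"
  shows "of_real (sin \<gamma>) * (C - A) = of_real (sin \<beta>) * cis \<alpha> * (B - A)"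
proof -
  obtain r where r: "C - A = of_real r * cis \<alpha> * (B - A)"
    using ccw_angle_polar[of A B C \<alpha>] assms by (auto simp: has_angles_def)
  have "ccw_triangle B C A" using assms(1) by (simp add: ccw_triangle_def algebra_simps)
  then obtain q where q: "A - B = of_real q * cis \<beta> * (C - B)" "q > 0"
    using ccw_angle_polar[of B C A \<beta>] assms by (auto simp: has_angles_def)
  have nz: "B - A \<noteq> 0" using assms(1) by (auto simp: ccw_triangle_def)
  \<comment> \<open>The outcome is real, so the imaginary part, a multiple of \<open>q\<close>, vanishes; this determines \<open>r\<close> alone.\<close>
  have "(of_real r * cis \<alpha> - 1) * (of_real q * cis \<beta>) * (B - A) = of_real q * cis \<beta> * ((C - A) - (B - A))"
    unfolding r by (simp add: algebra_simps)
  also have "\<dots> = - 1 * (B - A)" using q by (simp add: algebra_simps)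
  finally have "(of_real r * cis \<alpha> - 1) * (of_real q * cis \<beta>) = - 1"
    using nz by (metis mult_cancel_right)
  then have "of_real q * (of_real r * cis (\<alpha> + \<beta>) - cis \<beta>) = - 1"
    by (simp add: algebra_simps flip: cis_mult)
  from arg_cong[OF this, of Im] have "q * (r * sin (\<alpha> + \<beta>) - sin \<beta>) = 0"
    by simp
  then have "r * sin (\<alpha> + \<beta>) = sin \<beta>" using q by simp
  moreover have "\<gamma> = pi - (\<alpha> + \<beta>)" using assms by simp
  ultimately have "r * sin \<gamma> = sin \<beta>" by simp
  then show ?thesis unfolding r by (metis mult.assoc mult.commute of_real_mult)
qed

section \<open>Chains of edges with given directions\<close>

lemma le_along_steps:
  fixes f :: "nat \<Rightarrow> 'a::order"
  assumes "\<And>i. l \<le> i \<Longrightarrow> i < m \<Longrightarrow> f i \<le> f (Suc i)" and "l \<le> m"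
  shows "f l \<le> f m"
  using assms(2,1) by (induction rule: dec_induct) (auto intro: order_trans less_imp_le)

text \<open>Lengths of the edges are left open, since only the directions decide on which side
  of a line the chain proceeds.\<close>
definition edge_directions :: "(nat \<Rightarrow> complex) \<Rightarrow> complex \<Rightarrow> (nat \<Rightarrow> real) \<Rightarrow> nat \<Rightarrow> bool"
  where "edge_directions V u s n \<longleftrightarrow>
    (\<forall>i<n. \<exists>r>0. V (Suc i) - V i = of_real r * (cis (s i) * u))"

lemma edge_directions_full_turn:
  assumes "edge_directions V u s n" and "\<And>i. t i = s i + 2 * pi \<or> s i = t i + 2 * pi"
  shows "edge_directions V u t n"
proof -
  have "cis (t i) = cis (s i)" for i
    using assms(2)[of i] by (auto simp: complex_eq_iff)
  then show ?thesis using assms(1) by (simp add: edge_directions_def)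
qed

lemma edge_directions_frame:
  assumes "edge_directions V (cis r * u) s n"
  shows "edge_directions V u (\<lambda>i. s i + r) n"
  using assms by (simp add: edge_directions_def cis_mult flip: mult.assoc)

lemma chain_increasing:
  assumes V: "edge_directions V u s n"
    and s: "\<And>i. l \<le> i \<Longrightarrow> i < m \<Longrightarrow> 0 \<le> s i - \<phi> \<and> s i - \<phi> \<le> pi"
    and "l \<le> m" "m \<le> n"
  shows "side (cis \<phi> * u) (V l) \<le> side (cis \<phi> * u) (V m)"
proof (rule le_along_steps[OF _ \<open>l \<le> m\<close>])
  fix i assume i: "l \<le> i" "i < m"
  then obtain r where "r > 0" "V (Suc i) - V i = of_real r * (cis (s i) * u)"
    using V \<open>m \<le> n\<close> unfolding edge_directions_def by (meson less_le_trans)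
  then have "side (cis \<phi> * u) (V (Suc i) - V i) \<ge> 0"
    using s[OF i] by (simp add: side_cis sin_ge_zero)
  then show "side (cis \<phi> * u) (V i) \<le> side (cis \<phi> * u) (V (Suc i))"
    by (simp add: side_diff)
qed

lemma chain_decreasing:
  assumes V: "edge_directions V u s n"
    and s: "\<And>i. l \<le> i \<Longrightarrow> i < m \<Longrightarrow> - pi \<le> s i - \<phi> \<and> s i - \<phi> \<le> 0"
    and "l \<le> m" "m \<le> n"
  shows "side (cis \<phi> * u) (V m) \<le> side (cis \<phi> * u) (V l)"
proof -
  have flip: "side (cis (\<phi> - pi) * u) p = - side (cis \<phi> * u) p" for p
  proof -
    have "cis (\<phi> - pi) = - cis \<phi>" by (simp add: complex_eq_iff)
    then show ?thesis by (simp add: side_def algebra_simps)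
  qed
  have "side (cis (\<phi> - pi) * u) (V l) \<le> side (cis (\<phi> - pi) * u) (V m)"
    using s by (intro chain_increasing[OF V] assms) force
  then show ?thesis by (simp add: flip)
qed

text \<open>A chain that turns right, seen across a fixed line, first rises and then falls: the increments
  have the signs of \<open>sin (s i - \<phi>)\<close>, and these change at most once, from plus to minus. Hence no
  vertex lies lower than both ends.\<close>
lemma chain_quasiconcave:
  assumes V: "edge_directions V u s n" and "antimono s"
    and range: "\<And>i. l \<le> i \<Longrightarrow> i < m \<Longrightarrow> \<bar>s i - \<phi>\<bar> \<le> pi"
    and "t \<le> side (cis \<phi> * u) (V l)" "t \<le> side (cis \<phi> * u) (V m)"
    and "l \<le> j" "j \<le> m" "m \<le> n"
  shows "t \<le> side (cis \<phi> * u) (V j)"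
proof (cases "\<forall>i. l \<le> i \<and> i < j \<longrightarrow> \<phi> \<le> s i")
  case True
  have "side (cis \<phi> * u) (V l) \<le> side (cis \<phi> * u) (V j)"
  proof (rule chain_increasing[OF V])
    fix i assume "l \<le> i" "i < j"
    then show "0 \<le> s i - \<phi> \<and> s i - \<phi> \<le> pi" using True range[of i] assms by auto
  qed (use assms in auto)
  then show ?thesis using assms by simp
next
  case False
  then obtain i0 where i0: "l \<le> i0" "i0 < j" "s i0 < \<phi>" by (auto simp: not_le)
  have "side (cis \<phi> * u) (V m) \<le> side (cis \<phi> * u) (V j)"
  proof (rule chain_decreasing[OF V])
    fix i assume i: "j \<le> i" "i < m"
    then have "s i \<le> s i0" using \<open>antimono s\<close> i0 by (simp add: antimono_def)
    then show "- pi \<le> s i - \<phi> \<and> s i - \<phi> \<le> 0" using range[of i] i i0 by auto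
  qed (use assms in auto)
  then show ?thesis using assms by simp
qed

lemma antimono_arith: "y \<ge> 0 \<Longrightarrow> antimono (\<lambda>i. x - real i * y)"
  by (auto simp: antimono_def intro: mult_right_mono)

section \<open>The three fans\<close>

text \<open>A triangle with sides \<open>sin x\<close>, \<open>sin (a + x)\<close>, \<open>sin a\<close> closes up. It is the law of sines that
  governs each triangle of a fan, the triangle shared by two fans, and \<open>A B C\<close> itself.\<close>
lemma sin_cis_identity:
  "of_real (sin x) * cis a - of_real (sin (a + x)) = of_real (sin a) * cis (pi - x)"
  by (simp add: complex_eq_iff sin_add cos_diff)

lemma cis_add_pi: "cis (x + pi) = - cis x" "cis (pi - x) = - cis (- x)"
  by (simp_all add: complex_eq_iff)

lemma cis_diff_reflected: "cis (x + y) - cis (pi - (x - y)) = of_real (2 * cos x) * cis y"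
  by (simp add: complex_eq_iff cos_add cos_diff sin_add sin_diff)

text \<open>The point \<open>k\<close> of the fan at \<open>V\<close>. The law of sines in the \<open>k\<close>-th triangle of the fan asks for the ratio
  \<open>sin (b + k pi / n) / sin (c + (n - 1 - k) pi / n)\<close> of consecutive distances to \<open>V\<close>. The denominators
  are cleared here by a common factor, so that the distances are products, and one scale
  of the vectors \<open>u\<close> then serves all three corners.\<close>
definition corner_point ::
    "nat \<Rightarrow> real \<Rightarrow> real \<Rightarrow> real \<Rightarrow> complex \<Rightarrow> complex \<Rightarrow> nat \<Rightarrow> complex"
  where "corner_point n a b c V u k =
    V + of_real (sin_prod n b k * sin_prod n c (n - k)) * (cis (real k * a) * u)"

text \<open>The triangle \<open>A B C\<close> together with a vector along each side: \<open>u\<close> from \<open>A\<close> to \<open>B\<close>, \<open>v\<close> from \<open>B\<close> to \<open>C\<close>,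
  \<open>w\<close> from \<open>C\<close> to \<open>A\<close>, all of the same length. Each relation is listed for all three corners, so the
  assumptions are invariant under the cyclic shift \<open>(a, A, u)\<close>, \<open>(b, B, v)\<close>, \<open>(c, C, w)\<close>, and what is
  proved for the fan at \<open>A\<close> carries over to the other corners by \<open>rotate\<close>.\<close>
locale doughnut =
  fixes n :: nat and a b c :: real and A B C u v w :: complex
  assumes n: "n \<ge> 2" and pos: "a > 0" "b > 0" "c > 0"
    and sum: "real n * a + real n * b + real n * c = pi"
    and u: "u \<noteq> 0"
    and frames: "v = cis (pi - real n * b) * u" "w = cis (pi - real n * c) * v"
      "u = cis (pi - real n * a) * w"
    and sides: "B = A + of_real (sin_prod n c n) * u" "C = B + of_real (sin_prod n a n) * v"
      "A = C + of_real (sin_prod n b n) * w"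
begin

abbreviation "P \<equiv> corner_point n a b c A u"
abbreviation "Q \<equiv> corner_point n b c a B v"
abbreviation "R \<equiv> corner_point n c a b C w"

lemma rotate: "doughnut n b c a B C A v w u"
proof
  show "v \<noteq> 0" using frames(1) u by simp
qed (use n pos sum frames sides in auto)

lemma turn: "\<tau> / (2 * real n) = a + b + c"
  using sum n by (simp add: tau_def field_simps)

lemma shift_eq: "shift n x k = x + real k * (a + b + c)"
  by (simp add: shift_def turn)

lemma small: "a < pi / real n" "b < pi / real n" "c < pi / real n"
proof -
  have "pi / real n = a + b + c" using sum n by (simp add: field_simps)
  then show "a < pi / real n" "b < pi / real n" "c < pi / real n" using pos by auto
qed

lemma prods_pos: "k \<le> n \<Longrightarrow> sin_prod n a k > 0" "k \<le> n \<Longrightarrow> sin_prod n b k > 0"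
  "k \<le> n \<Longrightarrow> sin_prod n c k > 0"
  using sin_prod_pos small pos n by auto

lemma sum_less_pi: "real n * a < pi" "real n * b < pi" "real n * c < pi"
  "a < pi" "b < pi" "c < pi"
proof -
  have *: "real n * a > 0" "real n * b > 0" "real n * c > 0" using pos n by auto
  then show 1: "real n * a < pi" "real n * b < pi" "real n * c < pi" using sum by linarith+
  have "x \<le> real n * x" if "x > 0" for x
    using n that by (simp add: mult_le_cancel_right1)
  from this[OF pos(1)] this[OF pos(2)] this[OF pos(3)] 1
  show "a < pi" "b < pi" "c < pi" by linarith+
qed

lemma index_bound:
  assumes "m + i \<le> n" "x \<ge> 0"
  shows "real i * x \<le> real n * x - real m * x"
proof -
  have "(real m + real i) * x \<le> real n * x"
    using assms by (intro mult_right_mono) (simp_all flip: of_nat_add)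
  then show ?thesis by (simp add: algebra_simps)
qed

text \<open>Every comparison of directions is linear in the products of an index with \<open>a\<close>, \<open>b\<close>, \<open>c\<close>.
  The following bounds on these products, with \<open>n a + n b + n c = pi\<close>, reduce it to linear arithmetic.\<close>
lemma index_bounds:
  assumes "i < n"
  shows "0 \<le> real i * a" "0 \<le> real i * b" "0 \<le> real i * c"
    "real i * a \<le> real n * a - a" "real i * b \<le> real n * b - b" "real i * c \<le> real n * c - c"
  using index_bound[of 1 i a] index_bound[of 1 i b] index_bound[of 1 i c] assms pos by auto

lemma index_bounds_2:
  assumes "i < n - 1"
  shows "real i * a \<le> real n * a - 2 * a" "real i * b \<le> real n * b - 2 * b"
    "real i * c \<le> real n * c - 2 * c"
  using index_bound[of 2 i a] index_bound[of 2 i b] index_bound[of 2 i c] assms pos by auto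

lemma index_ge:
  assumes "1 \<le> i"
  shows "a \<le> real i * a" "b \<le> real i * b" "c \<le> real i * c"
  using assms pos by (simp_all add: mult_le_cancel_right1)

lemma P_polar: "P k - A = of_real (sin_prod n b k * sin_prod n c (n - k)) * (cis (real k * a) * u)"
  by (simp add: corner_point_def)

text \<open>The length formula explains the isosceles triangles (see \<open>hole_legs\<close>), and the direction formula
  everything else: at each vertex the chain \<open>P\<close> turns right by \<open>b + c\<close>.\<close>
lemma P_edge:
  assumes "k < n"
  shows "P (Suc k) - P k = of_real (sin a * sin_prod n b k * sin_prod n c (n - Suc k)) *
    (cis (pi - b - real k * (b + c)) * u)"
proof -
  define x where "x = shift n b k"
  let ?X = "complex_of_real (sin_prod n b k)" and ?Y = "complex_of_real (sin_prod n c (n - Suc k))"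
  have "n - k = Suc (n - Suc k)" using assms by simp
  moreover have "shift n c (n - Suc k) = pi - (a + x)"
    using assms sum by (simp add: x_def shift_eq of_nat_diff algebra_simps)
  ultimately have c: "sin_prod n c (n - k) = sin_prod n c (n - Suc k) * sin (a + x)"
    by (simp add: sin_prod_Suc)
  have b: "sin_prod n b (Suc k) = sin_prod n b k * sin x"
    by (simp add: sin_prod_Suc x_def)
  have "cis (real (Suc k) * a) = cis a * cis (real k * a)"
    by (simp add: cis_mult algebra_simps)
  then have "P (Suc k) - P k =
      ?X * ?Y * (of_real (sin x) * cis a - of_real (sin (a + x))) * (cis (real k * a) * u)"
    by (simp add: corner_point_def b c algebra_simps)
  also have "\<dots> = of_real (sin a) * ?X * ?Y * (cis (pi - x) * cis (real k * a) * u)"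
    unfolding sin_cis_identity by (simp add: algebra_simps)
  also have "cis (pi - x) * cis (real k * a) = cis (pi - b - real k * (b + c))"
    by (simp add: cis_mult x_def shift_eq algebra_simps)
  finally show ?thesis by simp
qed

lemma P_edge_pos: "k < n \<Longrightarrow> sin a * sin_prod n b k * sin_prod n c (n - Suc k) > 0"
  using prods_pos(2)[of k] prods_pos(3)[of "n - Suc k"] sin_gt_zero[OF pos(1) sum_less_pi(4)] by simp

lemma P_0: "P 0 = B"
  using sides(1) by (simp add: corner_point_def)

lemma P_n: "P n = C"
proof -
  have "cis (real n * a) * u = - w"
    using frames(3) by (simp add: cis_mult flip: mult.assoc)
  then show ?thesis using sides(3) by (simp add: corner_point_def)
qed

text \<open>Both fans place the third vertex of the triangle on the side \<open>A B\<close> by the same law of sines.\<close>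
lemma P_1: "P 1 = Q (n - 1)"
proof -
  have n1: "n - (n - 1) = Suc 0" using n by auto
  have S: "sin_prod n c n = sin_prod n c (n - 1) * sin (a + b)"
  proof -
    have "n = Suc (n - 1)" using n by simp
    then have "sin_prod n c n = sin_prod n c (n - 1) * sin (shift n c (n - 1))"
      using sin_prod_Suc[of n c "n - 1"] by simp
    moreover have "shift n c (n - 1) = pi - (a + b)"
      using n sum by (simp add: shift_eq of_nat_diff algebra_simps)
    ultimately show ?thesis by simp
  qed
  have "cis (real (n - 1) * b) * v = cis (pi - b) * u"
    using n frames(1) by (simp add: cis_mult of_nat_diff algebra_simps flip: mult.assoc)
  then have "Q (n - 1) = A + of_real (sin_prod n c (n - 1)) *
      ((of_real (sin (a + b)) + of_real (sin a) * cis (pi - b)) * u)"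
    by (simp only: corner_point_def n1 sin_prod_1 sides(1) S) (simp add: algebra_simps)
  \<comment> \<open>This is the closing of a triangle with angles \<open>a\<close>, \<open>b\<close>, \<open>pi - a - b\<close>, the shape of \<open>A B P 1\<close>.\<close>
  also have "of_real (sin (a + b)) + of_real (sin a) * cis (pi - b) = of_real (sin b) * cis a"
    unfolding sin_cis_identity[of b a, symmetric] by simp
  finally show ?thesis
    by (simp only: corner_point_def sin_prod_1 One_nat_def) (simp add: algebra_simps)
qed

lemma ccw: "ccw_triangle A B C"
proof -
  have C: "C - A = of_real (sin_prod n b n) * (cis (real n * a) * u)"
    using P_polar[of n] P_n by simp
  have "sin (real n * a) > 0" using sin_gt_zero[of "real n * a"] sum_less_pi pos n by simp
  then have "side (B - A) (C - A) > 0"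
    using side_cis[of 0 "of_real (sin_prod n c n) * u" "sin_prod n b n / sin_prod n c n" "real n * a"]
      prods_pos[of n] u sides(1) C by (simp add: zero_less_mult_iff)
  then show ?thesis by (simp add: ccw_triangle_def side_def)
qed

text \<open>The directions of all three chains are expressed relative to \<open>u\<close>. They decrease along each chain, and
  (for \<open>n \<ge> 3\<close>) going once around the hole along \<open>P\<close>, \<open>R\<close>, \<open>Q\<close> lowers them by one full turn in total:
  the hole is convex.\<close>
lemma P_directions: "edge_directions P u (\<lambda>i. pi - b - real i * (b + c)) n"
  unfolding edge_directions_def using P_edge P_edge_pos by blast

lemma Q_directions: "edge_directions Q u (\<lambda>i. - (real n * b) - c - real i * (c + a)) n"
proof -
  have "edge_directions Q u (\<lambda>i. pi - c - real i * (c + a) + (pi - real n * b)) n"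
    using doughnut.P_directions[OF rotate] unfolding frames(1)
    by (rule edge_directions_frame)
  \<comment> \<open>The frame \<open>v\<close> is turned by \<open>pi - n b\<close> against \<open>u\<close>; one full turn is removed.\<close>
  then show ?thesis by (rule edge_directions_full_turn) (simp add: algebra_simps)
qed

lemma R_directions: "edge_directions R u (\<lambda>i. real n * a - a - real i * (a + b)) n"
proof -
  have "edge_directions R u (\<lambda>i. - (real n * c) - a - real i * (a + b) + (pi - real n * b)) n"
    using doughnut.Q_directions[OF rotate] unfolding frames(1)
    by (rule edge_directions_frame)
  then show ?thesis by (rule back_subst[where P = "\<lambda>s. edge_directions R u s n"]) (use sum in auto)
qed

text \<open>Each angle is the difference of two of the directions \<open>k a\<close>, \<open>(k + 1) a\<close> and \<open>pi - b - k (b + c)\<close>, up to \<open>pi\<close>.\<close>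
lemma fan_at_A: "fan n a b c A P"
  unfolding fan_def
proof (intro allI impI conjI)
  fix k assume k: "k < n"
  define p q r where "p = sin_prod n b k * sin_prod n c (n - k)"
    and "q = sin_prod n b (Suc k) * sin_prod n c (n - Suc k)"
    and "r = sin a * sin_prod n b k * sin_prod n c (n - Suc k)"
  have pqr: "p > 0" "q > 0" "r > 0"
    using k prods_pos P_edge_pos[OF k] by (simp_all add: p_def q_def r_def)
  have Pk: "P k - A = of_real p * (cis (real k * a) * u)"
    and Pk1: "P (Suc k) - A = of_real q * (cis (real (Suc k) * a) * u)"
    and e: "P (Suc k) - P k = of_real r * (cis (pi - b - real k * (b + c)) * u)"
    unfolding p_def q_def r_def by (rule P_polar P_polar P_edge[OF k])+
  have Pk': "A - P k = of_real p * (cis (real k * a + pi) * u)"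
    and Pk1': "A - P (Suc k) = of_real q * (cis (real (Suc k) * a + pi) * u)"
    and e': "P k - P (Suc k) = of_real r * (cis (pi - b - real k * (b + c) + pi) * u)"
    using Pk Pk1 e by (simp_all only: cis_add_pi mult_minus_left mult_minus_right minus_diff_eq
        flip: Pk Pk1 e)
  have s: "side (P k - A) (P (Suc k) - A) > 0"
    unfolding Pk Pk1 side_scale side_cis
    using pqr u sin_gt_zero[OF pos(1) sum_less_pi(4)] by (simp add: algebra_simps)
  then show "ccw_triangle A (P k) (P (k + 1))"
    by (simp add: ccw_triangle_def side_def)
  have angles: "real k * a + pi - (pi - b - real k * (b + c)) = shift n b k"
    "pi - b - real k * (b + c) + pi - (real (Suc k) * a + pi) = shift n c (n - 1 - k)"
    using k sum by (simp_all add: shift_eq of_nat_diff algebra_simps)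
  have range: "0 \<le> shift n b k" "shift n b k \<le> pi" "0 \<le> shift n c (n - 1 - k)"
    "shift n c (n - 1 - k) \<le> pi"
    unfolding angles[symmetric] of_nat_Suc distrib_left distrib_right
    using index_bounds[OF k] pos sum by linarith+
  have 1: "angle (P k) A (P (Suc k)) = a"
    using angle_cis(1)[OF Pk Pk1] pqr u pos sum_less_pi by (simp add: algebra_simps)
  have 2: "angle (P (Suc k)) (P k) A = shift n b k"
    using angle_cis(1)[OF e Pk'] pqr u range unfolding angles by simp
  have 3: "angle A (P (Suc k)) (P k) = shift n c (n - 1 - k)"
    using angle_cis(1)[OF Pk1' e'] pqr u range unfolding angles by simp
  show "has_angles A (P k) (P (k + 1)) a (shift n b k) (shift n c (n - 1 - k))"
    using 1 2 3 by (simp add: has_angles_def)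
qed

section \<open>The isosceles triangles\<close>

text \<open>The legs at \<open>P 1\<close> are an edge of \<open>P\<close> and an edge of \<open>Q\<close>. They have equal length because
  \<open>sin a * sin b * sin_prod n c (n - 2)\<close> is symmetric in \<open>a\<close> and \<open>b\<close>.\<close>
lemma hole_legs:
  defines "r \<equiv> sin a * sin b * sin_prod n c (n - 2)"
  shows "r > 0"
    and "P 2 - P 1 = of_real r * (cis (pi - 2 * b - c) * u)"
    and "Q (n - 2) - P 1 = of_real r * (cis (2 * a + c) * u)"
proof -
  show "r > 0" using P_edge_pos[of 1] n by (simp add: r_def numeral_2_eq_2)
  show "P 2 - P 1 = of_real r * (cis (pi - 2 * b - c) * u)"
    using P_edge[of 1] n by (simp add: r_def numeral_2_eq_2 algebra_simps)
  define m where "m = n - 2"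
  have m: "n = Suc (Suc m)" using n by (simp add: m_def)
  have "Q (Suc m) - Q m = of_real r * (cis (pi - c - real m * (c + a)) * v)"
    using doughnut.P_edge[OF rotate, of m] m by (simp add: r_def mult_ac)
  also have "cis (pi - c - real m * (c + a)) * v = - (cis (2 * a + c) * u)"
  proof -
    have "real m = real n - 2" using m by simp
    then have "pi - c - real m * (c + a) + (pi - real n * b) = 2 * a + c + pi"
      unfolding \<open>real m = real n - 2\<close> using sum by (simp add: algebra_simps)
    then have "cis (pi - c - real m * (c + a)) * v = cis (2 * a + c + pi) * u"
      by (simp only: frames(1) cis_mult flip: mult.assoc)
    then show ?thesis by (simp only: cis_add_pi mult_minus_left)
  qed
  finally show "Q (n - 2) - P 1 = of_real r * (cis (2 * a + c) * u)"
    using P_1 m by (simp add: algebra_simps)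
qed

text \<open>The base is perpendicular to the bisector of the legs, whose direction is the mean of
  \<open>2 a + c\<close> and \<open>pi - 2 b - c\<close>, that is \<open>a - b + pi / 2\<close>.\<close>
lemma hole_base:
  defines "r \<equiv> 2 * cos (a + b + c) * (sin a * sin b * sin_prod n c (n - 2))"
  assumes "n \<ge> 3"
  shows "r > 0" and "Q (n - 2) - P 2 = of_real r * (cis (a - b) * u)"
proof -
  \<comment> \<open>The angle \<open>a + b + c = pi / n\<close> is at most \<open>pi / 3\<close>, so its cosine is positive.\<close>
  have "3 * (a + b + c) \<le> real n * (a + b + c)"
    using assms pos by (intro mult_right_mono) auto
  then have "a + b + c < pi / 2" using sum pos unfolding distrib_left by linarith
  then have "cos (a + b + c) > 0" using pos by (intro cos_gt_zero) auto
  then show "r > 0" using hole_legs(1) by (simp add: r_def)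
  have "cis (2 * a + c) - cis (pi - 2 * b - c) = of_real (2 * cos (a + b + c)) * cis (a - b)"
  proof -
    have e: "2 * a + c = (a + b + c) + (a - b)" "pi - 2 * b - c = pi - ((a + b + c) - (a - b))"
      by simp_all
    show ?thesis unfolding e by (rule cis_diff_reflected)
  qed
  moreover have "Q (n - 2) - P 2 = (Q (n - 2) - P 1) - (P 2 - P 1)" by simp
  ultimately show "Q (n - 2) - P 2 = of_real r * (cis (a - b) * u)"
    unfolding hole_legs r_def by (simp add: algebra_simps)
qed

lemma isosceles_at_P_1:
  assumes "n \<ge> 3"
  shows "hole_triangle n (P 1) (P 2) (Q (n - 2))"
proof -
  define r q where "r = sin a * sin b * sin_prod n c (n - 2)"
    and "q = 2 * cos (a + b + c) * (sin a * sin b * sin_prod n c (n - 2))"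
  have rq: "r > 0" "q > 0"
    using hole_legs(1) hole_base(1)[OF assms] by (simp_all add: r_def q_def)
  have leg1: "P 2 - P 1 = of_real r * (cis (pi - 2 * b - c) * u)"
    and leg2: "Q (n - 2) - P 1 = of_real r * (cis (2 * a + c) * u)"
    and base: "Q (n - 2) - P 2 = of_real q * (cis (a - b) * u)"
    unfolding r_def q_def using hole_legs(2,3) hole_base(2)[OF assms] by blast+
  have "cis (pi - 2 * b - c) = - cis (- 2 * b - c)"
    using cis_add_pi(1)[of "- 2 * b - c"] by (simp add: algebra_simps)
  then have leg1': "P 1 - P 2 = of_real r * (cis (- 2 * b - c) * u)"
    using leg1 by (simp add: algebra_simps)
  have leg2': "P 1 - Q (n - 2) = of_real r * (cis (2 * a + c + pi) * u)"
    using leg2 by (simp add: cis_add_pi) (simp add: algebra_simps)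
  have base': "P 2 - Q (n - 2) = of_real q * (cis (a - b + pi) * u)"
    using base by (simp add: cis_add_pi) (simp add: algebra_simps)
  have bound: "0 \<le> a + b + c" "a + b + c \<le> pi" "2 * (a + b + c) < pi"
  proof -
    have "3 * (a + b + c) \<le> real n * (a + b + c)"
      using assms pos by (intro mult_right_mono) auto
    then show "0 \<le> a + b + c" "a + b + c \<le> pi" "2 * (a + b + c) < pi"
      using pos sum by (auto simp: algebra_simps)
  qed
  have apex: "angle (P 2) (P 1) (Q (n - 2)) = pi - 2 * (a + b + c)"
    using angle_cis(2)[OF leg2 leg1] rq u bound by (simp add: algebra_simps)
  have base1: "angle (Q (n - 2)) (P 2) (P 1) = a + b + c"
    using angle_cis(2)[OF leg1' base] rq u bound by (simp add: algebra_simps)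
  have base2: "angle (P 1) (Q (n - 2)) (P 2) = a + b + c"
    using angle_cis(2)[OF base' leg2'] rq u bound by (simp add: algebra_simps)
  have "(real n - 2) / (2 * real n) * \<tau> = real n * (a + b + c) - 2 * (a + b + c)"
    unfolding turn[symmetric] using n by (simp add: field_simps)
  also have "\<dots> = pi - 2 * (a + b + c)" using sum by (simp add: algebra_simps)
  finally have t: "(real n - 2) / (2 * real n) * \<tau> = pi - 2 * (a + b + c)" .
  have "dist (P 1) (P 2) = dist (P 1) (Q (n - 2))"
    unfolding dist_norm leg1' leg2' by (simp add: norm_mult)
  moreover have "\<not> collinear {P 1, P 2, Q (n - 2)}"
  proof (rule not_collinear_if_side)
    have "sin (pi - 2 * b - c - (2 * a + c)) > 0"
      using bound pos by (intro sin_gt_zero) auto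
    then show "side (Q (n - 2) - P 1) (P 2 - P 1) \<noteq> 0"
      unfolding leg1 leg2 side_scale side_cis using rq u by simp
  qed
  ultimately show ?thesis
    unfolding hole_triangle_def has_angles_def using apex base1 base2 turn t by simp
qed

section \<open>Positions of the points relative to lines\<close>

lemma P_side_of_ray:
  assumes "j \<le> n" "m \<le> n"
  shows "j \<le> m \<Longrightarrow> side (cis (real m * a) * u) (P j) \<le> side (cis (real m * a) * u) A"
    and "m \<le> j \<Longrightarrow> side (cis (real m * a) * u) (P j) \<ge> side (cis (real m * a) * u) A"
proof -
  have eq: "side (cis (real m * a) * u) (P j) - side (cis (real m * a) * u) A =
      sin_prod n b j * sin_prod n c (n - j) * ((norm u)\<^sup>2 * sin (real j * a - real m * a))"
    by (simp only: side_cis P_polar flip: side_diff)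
  have pos': "sin_prod n b j * sin_prod n c (n - j) > 0"
    using prods_pos assms by simp
  have range: "real j * a \<le> real n * a" "real m * a \<le> real n * a" "0 \<le> real j * a" "0 \<le> real m * a"
    using assms pos by auto
  show "side (cis (real m * a) * u) (P j) \<le> side (cis (real m * a) * u) A" if "j \<le> m"
  proof -
    have "real j * a \<le> real m * a" using that pos by simp
    then have "sin (real m * a - real j * a) \<ge> 0"
      using range sum_less_pi by (intro sin_ge_zero) auto
    then have "sin (real j * a - real m * a) \<le> 0"
      using sin_minus[of "real m * a - real j * a"] by simp
    then show ?thesis using eq pos' by (smt (verit) mult_nonneg_nonpos zero_le_power2)
  qed
  show "side (cis (real m * a) * u) (P j) \<ge> side (cis (real m * a) * u) A" if "m \<le> j"
  proof -
    have "real m * a \<le> real j * a" using that pos by simp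
    then have "sin (real j * a - real m * a) \<ge> 0"
      using range sum_less_pi by (intro sin_ge_zero) auto
    then show ?thesis using eq pos' by (smt (verit) mult_nonneg_nonneg zero_le_power2)
  qed
qed

text \<open>The chain \<open>P\<close> turns right from \<open>B\<close> to \<open>C\<close>, so it stays on the left of its chord, the side \<open>B C\<close>.\<close>
lemma P_above_BC:
  assumes "j \<le> n"
  shows "side v (P j) \<ge> side v B"
  unfolding frames(1)
proof (rule chain_quasiconcave[OF P_directions, where l = 0 and m = n])
  show "antimono (\<lambda>i. pi - b - real i * (b + c))" using pos by (intro antimono_arith) simp
  fix i assume "i < n"
  then show "\<bar>pi - b - real i * (b + c) - (pi - real n * b)\<bar> \<le> pi"
    using index_bounds[OF \<open>i < n\<close>] sum pos sum_less_pi
    unfolding distrib_left abs_le_iff by (intro conjI; linarith)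
next
  have "side v C = side v B"
    unfolding sides(2) by (simp add: side_def algebra_simps)
  then show "side (cis (pi - real n * b) * u) B \<le> side (cis (pi - real n * b) * u) (P n)"
    using frames(1) P_n by simp
qed (use assms P_0 in auto)

lemma P_in_triangle:
  assumes "j \<le> n"
  shows "P j \<in> convex hull {A, B, C}"
proof (rule in_triangle_if_left_of_sides[OF ccw])
  have "B - A = of_real (sin_prod n c n) * (cis (real 0 * a) * u)"
    using sides(1) by simp
  then show "side (B - A) (P j - A) \<ge> 0"
    using P_side_of_ray(2)[of j 0] assms prods_pos[of n] by (simp add: side_scale side_diff)
  have "C - B = of_real (sin_prod n a n) * v"
    using sides(2) by simp
  then show "side (C - B) (P j - B) \<ge> 0"
    using P_above_BC[OF assms] prods_pos[of n] by (simp add: side_scale side_diff)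
  have AC: "A - C = - (of_real (sin_prod n b n) * (cis (real n * a) * u))"
    using P_polar[of n] P_n by (simp add: algebra_simps)
  moreover have "side (A - C) A = side (A - C) C"
    by (simp add: side_def algebra_simps)
  ultimately show "side (A - C) (P j - C) \<ge> 0"
    using P_side_of_ray(1)[of j n] assms prods_pos[of n] side_scale[of "- sin_prod n b n"]
    by (simp add: side_diff)
qed

text \<open>The direction from \<open>P (k + 1)\<close> to \<open>P k\<close>. With this orientation the hole lies to the left of the
  edge, where \<open>side\<close> is larger, and the corner \<open>A\<close> to the right.\<close>
abbreviation rev_edge :: "nat \<Rightarrow> complex"
  where "rev_edge k \<equiv> cis (- b - real k * (b + c)) * u"

text \<open>Walking away from the \<open>k\<close>-th edge in either direction, the chain has turned by less than a half
  turn, so it keeps moving away from the line of that edge.\<close>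
lemma P_beyond_edge:
  assumes "k < n" "j \<le> n"
  shows "side (rev_edge k) (P j) \<ge> side (rev_edge k) (P k)"
proof (cases "k \<le> j")
  case True
  show ?thesis
  proof (rule chain_increasing[OF P_directions])
    fix i assume i: "k \<le> i" "i < j"
    have "real k * b \<le> real i * b" "real k * c \<le> real i * c" using i pos by auto
    moreover have "i < n" using i assms by simp
    ultimately show "0 \<le> pi - b - real i * (b + c) - (- b - real k * (b + c)) \<and>
        pi - b - real i * (b + c) - (- b - real k * (b + c)) \<le> pi"
      using index_bounds[OF \<open>i < n\<close>] index_bounds[OF \<open>k < n\<close>] sum pos
      unfolding distrib_left abs_le_iff by (intro conjI; linarith)
  qed (use assms True in auto)
next
  case False
  \<comment> \<open>Lowering the directions by a full turn brings the earlier edges into the range of a decrease.\<close>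
  have "edge_directions P u (\<lambda>i. - pi - b - real i * (b + c)) n"
    using P_directions by (rule edge_directions_full_turn) simp
  then show ?thesis
  proof (rule chain_decreasing)
    fix i assume i: "j \<le> i" "i < k"
    have "real i * b \<le> real k * b" "real i * c \<le> real k * c" using i pos by auto
    moreover have "i < n" using i assms by simp
    ultimately show "- pi \<le> - pi - b - real i * (b + c) - (- b - real k * (b + c)) \<and>
        - pi - b - real i * (b + c) - (- b - real k * (b + c)) \<le> 0"
      using index_bounds[OF \<open>i < n\<close>] index_bounds[OF \<open>k < n\<close>] sum pos
      unfolding distrib_left abs_le_iff by (intro conjI; linarith)
  qed (use assms False in auto)
qed

lemma rev_edge_Suc:
  assumes "k < n"
  shows "side (rev_edge k) (P (Suc k)) = side (rev_edge k) (P k)"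
proof -
  have "side (rev_edge k) (P (Suc k) - P k) = 0"
    unfolding P_edge[OF assms] side_cis by simp
  then show ?thesis by (simp add: side_diff)
qed

lemma A_behind_edge:
  assumes "k < n"
  shows "side (rev_edge k) A \<le> side (rev_edge k) (P k)"
proof -
  have "real k * a - (- b - real k * (b + c)) = shift n b k"
    by (simp add: shift_eq algebra_simps)
  moreover have "sin (shift n b k) > 0"
    using sin_shift_pos[of n b k] assms n pos small by simp
  ultimately have "side (rev_edge k) (P k - A) \<ge> 0"
    unfolding P_polar side_cis using prods_pos[of k] prods_pos[of "n - k"] assms by simp
  then show ?thesis by (simp add: side_diff)
qed

text \<open>The chain \<open>Q\<close> joins \<open>P n = C\<close> to \<open>P 1\<close>, and both ends are beyond the edge by \<open>P_beyond_edge\<close>.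
  Quasi-concavity carries this over to the vertices between them.\<close>
lemma Q_beyond_edge:
  assumes "k < n" "j < n"
  shows "side (rev_edge k) (Q j) \<ge> side (rev_edge k) (P k)"
proof (rule chain_quasiconcave[OF Q_directions, where l = 0 and m = "n - 1"])
  show "antimono (\<lambda>i. - (real n * b) - c - real i * (c + a))"
    using pos by (intro antimono_arith) simp
  show "\<bar>- (real n * b) - c - real i * (c + a) - (- b - real k * (b + c))\<bar> \<le> pi"
    if "i < n - 1" for i
  proof -
    have "i < n" using that by simp
    show ?thesis
      using index_bounds_2[OF that] index_bounds[OF \<open>i < n\<close>] index_bounds[OF \<open>k < n\<close>] sum pos
      unfolding distrib_left abs_le_iff by (intro conjI; linarith)
  qed
  show "side (rev_edge k) (P k) \<le> side (rev_edge k) (Q 0)"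
    using doughnut.P_0[OF rotate] P_n P_beyond_edge[of k n] assms by simp
  show "side (rev_edge k) (P k) \<le> side (rev_edge k) (Q (n - 1))"
    using P_1 P_beyond_edge[of k 1] assms n by simp
qed (use assms in auto)

text \<open>Between \<open>R 1 = P (n - 1)\<close> and \<open>R (n - 1) = Q 1\<close>, which are beyond the edge, quasi-concavity applies
  again.\<close>
lemma R_beyond_edge:
  assumes "k < n" "1 \<le> j" "j < n"
  shows "side (rev_edge k) (R j) \<ge> side (rev_edge k) (P k)"
proof (rule chain_quasiconcave[OF R_directions, where l = 1 and m = "n - 1"])
  show "antimono (\<lambda>i. real n * a - a - real i * (a + b))"
    using pos by (intro antimono_arith) simp
  show "\<bar>real n * a - a - real i * (a + b) - (- b - real k * (b + c))\<bar> \<le> pi"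
    if "1 \<le> i" "i < n - 1" for i
  proof -
    have "i < n" using that by simp
    then show ?thesis
      using index_bounds_2[OF that(2)] index_bounds[OF \<open>i < n\<close>]
        index_bounds[OF \<open>k < n\<close>] index_ge[OF that(1)] sum pos
      unfolding distrib_left abs_le_iff by (intro conjI; linarith)
  qed
  show "side (rev_edge k) (P k) \<le> side (rev_edge k) (R 1)"
    using doughnut.P_1[OF doughnut.rotate[OF rotate]] P_beyond_edge[of k "n - 1"] assms by simp
  show "side (rev_edge k) (P k) \<le> side (rev_edge k) (R (n - 1))"
    using doughnut.P_1[OF rotate] Q_beyond_edge[of k 1] assms n by simp
qed (use assms in auto)

text \<open>A chord of a chain that turns right has the vertices between its ends on the left: the area
  in question is a sum over pairs of an earlier and a later edge, each of them a right turn.\<close>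
lemma side_of_chord:
  assumes "l < m" "m \<le> n" "l \<le> j" "j \<le> m"
  shows "side (P m - P l) (P j) \<ge> side (P m - P l) (P l)"
proof -
  \<comment> \<open>Replacing \<open>P m - P l\<close> by \<open>P m - P j\<close> does not change the cross product with \<open>P j - P l\<close>.\<close>
  have "side (P m - P j) (P l) \<le> side (P m - P j) (P j)"
  proof (rule le_along_steps[OF _ \<open>l \<le> j\<close>])
    fix i assume i: "l \<le> i" "i < j"
    then have "i < n" using assms by simp
    have "side (cis (pi - b - real i * (b + c)) * u) (P m) \<le>
        side (cis (pi - b - real i * (b + c)) * u) (P j)"
    proof (rule chain_decreasing[OF P_directions])
      fix t assume t: "j \<le> t" "t < m"
      have "real i * b \<le> real t * b" "real i * c \<le> real t * c" using i t pos by auto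
      moreover have "t < n" using t assms by simp
      ultimately show "- pi \<le> pi - b - real t * (b + c) - (pi - b - real i * (b + c)) \<and>
          pi - b - real t * (b + c) - (pi - b - real i * (b + c)) \<le> 0"
        using index_bounds[OF \<open>t < n\<close>] index_bounds[OF \<open>i < n\<close>] sum pos
        unfolding distrib_left by (intro conjI; linarith)
    qed (use assms in auto)
    then have "side (P (Suc i) - P i) (P m - P j) \<le> 0"
      unfolding P_edge[OF \<open>i < n\<close>] side_scale side_diff
      using P_edge_pos[OF \<open>i < n\<close>] by (simp add: mult_le_cancel_left)
    then show "side (P m - P j) (P i) \<le> side (P m - P j) (P (Suc i))"
      by (simp add: side_def algebra_simps)
  qed
  then show ?thesis by (simp add: side_def algebra_simps)
qed

lemma A_side_of_chord:
  assumes "l < m" "m \<le> n"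
  shows "side (P m - P l) A \<ge> side (P m - P l) (P l)"
proof -
  have "side (P l - A) (P m - A) \<ge> 0"
    unfolding P_polar[of l] side_scale
    using P_side_of_ray(2)[of m l] prods_pos[of l] prods_pos[of "n - l"] assms
    by (simp add: side_diff)
  then show ?thesis by (simp add: side_def algebra_simps)
qed

section \<open>Disjointness\<close>

text \<open>The ray from \<open>A\<close> through \<open>P (k + 1)\<close> separates the two triangles.\<close>
lemma fan_separated:
  assumes "k < k'" "k' < n"
  shows "disjoint_triangles {A, P k', P (Suc k')} {A, P k, P (Suc k)}"
proof (rule disjoint_triangles_separated)
  show "cis (real (Suc k) * a) * u \<noteq> 0" using u by simp
qed (use P_side_of_ray[of _ "Suc k"] assms in auto)

lemma P_1_neq_C: "P 1 \<noteq> C"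
proof
  assume "P 1 = C"
  then have eq: "side (cis (real 1 * a) * u) (P 1 - A) = side (cis (real 1 * a) * u) (P n - A)"
    using P_n by simp
  have "a < real n * a" using n pos by simp
  then have "sin (real n * a - a) > 0"
    using sum_less_pi pos by (intro sin_gt_zero) auto
  then show False
    using eq u prods_pos[of n] unfolding P_polar side_cis by simp
qed

text \<open>The line from the shared point \<open>P 1 = Q (n - 1)\<close> to the opposite corner \<open>C = P n = Q 0\<close> is a chord of
  both chains. The fan at \<open>A\<close> lies on its left and the fan at \<open>B\<close> on its right, except for the
  triangle that they share.\<close>
lemma fans_separated:
  assumes "1 \<le> k" "k < n" "j < n - 1"
  shows "disjoint_triangles {A, P k, P (Suc k)} {B, Q j, Q (Suc j)}"
proof (rule disjoint_triangles_separated)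
  show "C - P 1 \<noteq> 0" using P_1_neq_C by simp
  have "side (C - P 1) (P i) \<ge> side (C - P 1) (P 1)" if "1 \<le> i" "i \<le> n" for i
    using side_of_chord[of 1 n i] that n P_n by simp
  moreover have "side (C - P 1) A \<ge> side (C - P 1) (P 1)"
    using A_side_of_chord[of 1 n] n P_n by simp
  ultimately show "side (C - P 1) p \<ge> side (C - P 1) (P 1)" if "p \<in> {A, P k, P (Suc k)}" for p
    using that assms by auto
  \<comment> \<open>\<open>C = Q 0\<close> and \<open>P 1 = Q (n - 1)\<close> also span a chord of the chain \<open>Q\<close>, in the opposite direction.\<close>
  have flip: "side (C - P 1) p \<le> side (C - P 1) (P 1)"
    if "side (P 1 - C) p \<ge> side (P 1 - C) C" for p
    using that by (simp add: side_def algebra_simps)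
  have "side (P 1 - C) (Q i) \<ge> side (P 1 - C) C" if "i \<le> n - 1" for i
    using doughnut.side_of_chord[OF rotate, of 0 "n - 1" i] that n P_1 doughnut.P_0[OF rotate]
    by simp
  moreover have "side (P 1 - C) B \<ge> side (P 1 - C) C"
    using doughnut.A_side_of_chord[OF rotate, of 0 "n - 1"] n P_1 doughnut.P_0[OF rotate]
    by simp
  ultimately show "side (C - P 1) p \<le> side (C - P 1) (P 1)" if "p \<in> {B, Q j, Q (Suc j)}" for p
    using that assms by (auto intro!: flip simp del: One_nat_def)
qed

abbreviation "hole_points \<equiv> P ` {1..<n} \<union> Q ` {1..<n} \<union> R ` {1..<n}"

text \<open>The separating line contains the edge of the fan triangle opposite to its corner. It is a
  supporting line of the convex hole.\<close>
lemma fan_hole_separated: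
  assumes "k < n" "T \<subseteq> hole_points"
  shows "disjoint_triangles T {A, P k, P (Suc k)}"
proof (rule disjoint_triangles_separated)
  show "rev_edge k \<noteq> 0" using u by simp
  show "side (rev_edge k) p \<le> side (rev_edge k) (P k)" if "p \<in> {A, P k, P (Suc k)}" for p
    using that A_behind_edge[OF \<open>k < n\<close>] rev_edge_Suc[OF \<open>k < n\<close>] by auto
  show "side (rev_edge k) p \<ge> side (rev_edge k) (P k)" if "p \<in> T" for p
    using that assms P_beyond_edge[of k] Q_beyond_edge[of k] R_beyond_edge[of k] by auto
qed

text \<open>The base of the isosceles triangle at \<open>P 1\<close> cuts off \<open>P 1\<close> from the other vertices of the hole. The
  chains leave the base at \<open>P 2\<close> and at \<open>Q (n - 2)\<close> towards its far side.\<close>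
lemma hole_triangles_separated:
  assumes "n \<ge> 4" and T: "T \<subseteq> P ` {2..<n} \<union> Q ` {1..<n - 1} \<union> R ` {1..<n}"
  shows "disjoint_triangles T {P 1, P 2, Q (n - 2)}"
proof (rule disjoint_triangles_separated)
  let ?s = "side (cis (a - b) * u)"
  show "cis (a - b) * u \<noteq> 0" using u by simp
  have Q: "?s (Q (n - 2)) = ?s (P 2)"
  proof -
    have "?s (Q (n - 2) - P 2) = 0"
      using hole_base(2) assms by (simp only: side_cis) simp
    then show ?thesis by (simp add: side_diff)
  qed
  have abc: "4 * a \<le> real n * a" "4 * b \<le> real n * b" "4 * c \<le> real n * c"
    using assms pos by auto
  have "?s (P 1) \<le> ?s (P 2)"
  proof (rule chain_increasing[OF P_directions])
    fix i :: nat assume "1 \<le> i" "i < 2"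
    then have "i = 1" by simp
    show "0 \<le> pi - b - real i * (b + c) - (a - b) \<and> pi - b - real i * (b + c) - (a - b) \<le> pi"
      unfolding \<open>i = 1\<close> of_nat_1 mult_1 using abc sum pos by (intro conjI; linarith)
  qed (use n in auto)
  then show "?s p \<le> ?s (P 2)" if "p \<in> {P 1, P 2, Q (n - 2)}" for p
    using that Q by auto
  have P': "?s (P j) \<ge> ?s (P 2)" if "2 \<le> j" "j \<le> n" for j
  proof (rule chain_increasing[OF P_directions _ that])
    fix i assume i: "2 \<le> i" "i < j"
    then have "i < n" using that by simp
    show "0 \<le> pi - b - real i * (b + c) - (a - b) \<and> pi - b - real i * (b + c) - (a - b) \<le> pi"
      using index_bounds[OF \<open>i < n\<close>] abc sum pos unfolding distrib_left by (intro conjI; linarith)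
  qed
  have Q': "?s (Q j) \<ge> ?s (P 2)" if "j \<le> n - 2" for j
  proof -
    have "?s (Q (n - 2)) \<le> ?s (Q j)"
    proof (rule chain_decreasing[OF Q_directions _ that])
      fix i assume i: "j \<le> i" "i < n - 2"
      then have "i < n" "i < n - 1" by auto
      show "- pi \<le> - (real n * b) - c - real i * (c + a) - (a - b) \<and>
          - (real n * b) - c - real i * (c + a) - (a - b) \<le> 0"
        using index_bounds[OF \<open>i < n\<close>] index_bounds_2[OF \<open>i < n - 1\<close>] abc sum pos
        unfolding distrib_left by (intro conjI; linarith)
    qed simp
    then show ?thesis using Q by simp
  qed
  \<comment> \<open>\<open>R\<close> runs from \<open>P (n - 1)\<close> to \<open>Q 1\<close>, which have been placed already.\<close>
  have R': "?s (R j) \<ge> ?s (P 2)" if "1 \<le> j" "j < n" for j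
  proof (rule chain_quasiconcave[OF R_directions, where l = 1 and m = "n - 1"])
    show "antimono (\<lambda>i. real n * a - a - real i * (a + b))"
      using pos by (intro antimono_arith) simp
    fix i assume i: "1 \<le> i" "i < n - 1"
    then have "i < n" by simp
    show "\<bar>real n * a - a - real i * (a + b) - (a - b)\<bar> \<le> pi"
      using index_bounds[OF \<open>i < n\<close>] index_bounds_2[OF i(2)] index_ge[OF i(1)] abc sum pos
      unfolding distrib_left abs_le_iff by (intro conjI; linarith)
  next
    show "?s (P 2) \<le> ?s (R 1)"
      using doughnut.P_1[OF doughnut.rotate[OF rotate]] P'[of "n - 1"] assms by simp
    show "?s (P 2) \<le> ?s (R (n - 1))"
      using doughnut.P_1[OF rotate] Q'[of 1] assms by simp
  qed (use that in auto)
  show "?s p \<ge> ?s (P 2)" if "p \<in> T" for p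
  proof -
    have "p \<in> P ` {2..<n} \<union> Q ` {1..<n - 1} \<union> R ` {1..<n}" using that T by blast
    then show ?thesis by (elim UnE imageE) (auto intro!: P' Q' R')
  qed
qed

lemma same_fan:
  assumes "S \<in> fan_triangles n A P" "T \<in> fan_triangles n A P" "S \<noteq> T"
  shows "disjoint_triangles S T"
proof -
  obtain k k' where k: "k < n" "S = {A, P k, P (Suc k)}" "k' < n" "T = {A, P k', P (Suc k')}"
    using assms unfolding fan_triangles_def by auto
  then have "k < k' \<or> k' < k" using assms(3) by (metis nat_neq_iff)
  then show ?thesis
    using fan_separated k disjoint_triangles_sym by blast
qed

lemma neighbouring_fans:
  assumes S: "S \<in> fan_triangles n A P" and T: "T \<in> fan_triangles n B Q" and "S \<noteq> T"
  shows "disjoint_triangles S T"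
proof -
  obtain k j where k: "k < n" "S = {A, P k, P (Suc k)}" and j: "j < n" "T = {B, Q j, Q (Suc j)}"
    using S T unfolding fan_triangles_def by auto
  have shared: "{A, P 0, P (Suc 0)} = {B, Q (n - 1), Q (Suc (n - 1))}"
    using P_0 P_1 n doughnut.P_n[OF rotate] by auto
  \<comment> \<open>If one of the triangles is the shared one, both belong to the same fan.\<close>
  consider "k = 0" | "j = n - 1" | "1 \<le> k" "j < n - 1" using j by linarith
  then show ?thesis
  proof cases
    case 1
    then have "S = {B, Q (n - 1), Q (Suc (n - 1))}" using k(2) shared by simp
    moreover have "n - 1 < n" using n by simp
    ultimately have "S \<in> fan_triangles n B Q" unfolding fan_triangles_def Suc_eq_plus1 by blast
    then show ?thesis using doughnut.same_fan[OF rotate] T \<open>S \<noteq> T\<close> by blast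
  next
    case 2
    then have "T = {A, P 0, P (Suc 0)}" using j(2) shared by simp
    moreover have "0 < n" using n by simp
    ultimately have "T \<in> fan_triangles n A P" unfolding fan_triangles_def Suc_eq_plus1 by blast
    then show ?thesis using same_fan S \<open>S \<noteq> T\<close> by blast
  next
    case 3
    then show ?thesis using fans_separated k j by simp
  qed
qed

lemma fan_and_hole:
  assumes "S \<in> fan_triangles n A P" "T \<subseteq> hole_points"
  shows "disjoint_triangles S T"
proof -
  obtain k where "k < n" "S = {A, P k, P (Suc k)}"
    using assms(1) unfolding fan_triangles_def by auto
  then show ?thesis
    using fan_hole_separated[OF _ assms(2), of k] disjoint_triangles_sym by simp
qed

lemma is_conway_doughnut: "conway_doughnut n a b c A B C P Q R"
proof -
  note rot = rotate and rot2 = doughnut.rotate[OF rotate]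
  have hull: "convex hull {B, C, A} = convex hull {A, B, C}" "convex hull {C, A, B} = convex hull {A, B, C}"
    by (simp_all add: insert_commute)
  have in_triangle: "\<forall>k\<le>n. P k \<in> convex hull {A, B, C} \<and> Q k \<in> convex hull {A, B, C} \<and>
      R k \<in> convex hull {A, B, C}"
    using P_in_triangle doughnut.P_in_triangle[OF rot] doughnut.P_in_triangle[OF rot2]
    unfolding hull by blast
  define F G H where "F = fan_triangles n A P" and "G = fan_triangles n B Q"
    and "H = fan_triangles n C R"
  define T1 T2 T3 where "T1 = {P 1, P 2, Q (n - 2)}" and "T2 = {Q 1, Q 2, R (n - 2)}"
    and "T3 = {R 1, R 2, P (n - 2)}"
  have both: "disjoint_triangles S T \<and> disjoint_triangles T S" if "disjoint_triangles S T" for S T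
    using that disjoint_triangles_sym by simp
  have FG: "disjoint_triangles S T \<and> disjoint_triangles T S" if "S \<in> F" "T \<in> G" "S \<noteq> T" for S T
    using that unfolding F_def G_def by (intro both neighbouring_fans)
  have GH: "disjoint_triangles S T \<and> disjoint_triangles T S" if "S \<in> G" "T \<in> H" "S \<noteq> T" for S T
    using that unfolding G_def H_def by (intro both doughnut.neighbouring_fans[OF rot])
  have HF: "disjoint_triangles S T \<and> disjoint_triangles T S" if "S \<in> H" "T \<in> F" "S \<noteq> T" for S T
    using that unfolding H_def F_def by (intro both doughnut.neighbouring_fans[OF rot2])
  have FGH: "disjoint_triangles S T"
    if "S \<in> F \<union> G \<union> H" "T \<in> F \<union> G \<union> H" "S \<noteq> T" for S T
    using that same_fan[of S T] doughnut.same_fan[OF rot, of S T] doughnut.same_fan[OF rot2, of S T]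
      FG[of S T] FG[of T S] GH[of S T] GH[of T S] HF[of S T] HF[of T S]
    unfolding F_def[symmetric] G_def[symmetric] H_def[symmetric]
    by (elim UnE) simp_all
  have fan_hole: "disjoint_triangles S T \<and> disjoint_triangles T S"
    if "S \<in> F \<union> G \<union> H" "T \<subseteq> hole_points" for S T
  proof (rule both)
    have "T \<subseteq> Q ` {1..<n} \<union> R ` {1..<n} \<union> P ` {1..<n}"
      "T \<subseteq> R ` {1..<n} \<union> P ` {1..<n} \<union> Q ` {1..<n}" using that(2) by blast+
    then show "disjoint_triangles S T"
      using that fan_and_hole[of S T] doughnut.fan_and_hole[OF rot, of S T]
        doughnut.fan_and_hole[OF rot2, of S T] unfolding F_def G_def H_def by (elim UnE) simp_all
  qed
  have holes: "T \<subseteq> hole_points" if "n \<ge> 3" "T \<in> {T1, T2, T3}" for T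
    using that unfolding T1_def T2_def T3_def by auto
  have hole_hole: "disjoint_triangles S T"
    if "n \<ge> 3" "S \<in> {T1, T2, T3}" "T \<in> {T1, T2, T3}" "S \<noteq> T" for S T
  proof (cases "n = 3")
    case True
    \<comment> \<open>For \<open>n = 3\<close> the hole is one triangle, so \<open>T1\<close>, \<open>T2\<close>, \<open>T3\<close> are the same set.\<close>
    have "P 1 = Q 2" "Q 1 = R 2" "R 1 = P 2"
      using True P_1 doughnut.P_1[OF rot] doughnut.P_1[OF rot2] by simp_all
    then have "T1 = T2" "T2 = T3" using True unfolding T1_def T2_def T3_def by auto
    then show ?thesis using that by simp
  next
    case False
    then have n4: "n \<ge> 4" using that by simp
    have "disjoint_triangles T2 T1" "disjoint_triangles T3 T1"
      unfolding T1_def T2_def T3_def using n4 by (intro hole_triangles_separated; auto)+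
    moreover have "disjoint_triangles T3 T2"
      unfolding T2_def T3_def using n4
      by (intro doughnut.hole_triangles_separated[OF rot]; auto)
    ultimately show ?thesis
      using that both[of T2 T1] both[of T3 T1] both[of T3 T2] by blast
  qed
  have "disjoint_triangles S T"
    if "S \<in> doughnut_triangles n A B C P Q R" "T \<in> doughnut_triangles n A B C P Q R" "S \<noteq> T" for S T
  proof (cases "n \<ge> 3")
    case True
    then have "doughnut_triangles n A B C P Q R = (F \<union> G \<union> H) \<union> {T1, T2, T3}"
      by (simp add: doughnut_triangles_def F_def G_def H_def T1_def T2_def T3_def)
    then have "S \<in> F \<union> G \<union> H \<or> S \<in> {T1, T2, T3}" "T \<in> F \<union> G \<union> H \<or> T \<in> {T1, T2, T3}"
      using that by blast+
    then show ?thesis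
      using FGH[of S T] fan_hole[of S T] fan_hole[of T S] holes[OF True] hole_hole[OF True] that(3)
      by (elim disjE) simp_all
  next
    case False
    then show ?thesis using that FGH by (simp add: doughnut_triangles_def F_def G_def H_def)
  qed
  then have "pairwise (\<lambda>S T. disjnt (interior (convex hull S)) (interior (convex hull T)))
      (doughnut_triangles n A B C P Q R)"
    unfolding pairwise_def disjoint_triangles_def by blast
  moreover have "n \<ge> 3 \<longrightarrow> hole_triangle n (P 1) (P 2) (Q (n - 2)) \<and>
      hole_triangle n (Q 1) (Q 2) (R (n - 2)) \<and> hole_triangle n (R 1) (R 2) (P (n - 2))"
    using isosceles_at_P_1 doughnut.isosceles_at_P_1[OF rot] doughnut.isosceles_at_P_1[OF rot2] by blast
  moreover have "P 0 = B \<and> P n = C \<and> Q 0 = C \<and> Q n = A \<and> R 0 = A \<and> R n = B \<and>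
      P 1 = Q (n - 1) \<and> Q 1 = R (n - 1) \<and> R 1 = P (n - 1)"
    by (intro conjI P_0 P_n P_1 doughnut.P_0[OF rot] doughnut.P_n[OF rot] doughnut.P_1[OF rot]
        doughnut.P_0[OF rot2] doughnut.P_n[OF rot2] doughnut.P_1[OF rot2])
  moreover note in_triangle fan_at_A doughnut.fan_at_A[OF rot] doughnut.fan_at_A[OF rot2]
  ultimately show ?thesis
    unfolding conway_doughnut_def by - (elim conjE, (intro conjI; assumption))
qed

end

section \<open>The given triangle\<close>

text \<open>The angles of the triangle determine the ratios of its sides by the law of sines. The product
  formula turns these ratios into quotients of values \<open>sin_prod n x n\<close>.\<close>
lemma doughnut_frame_exists:
  assumes "n \<ge> 2"
    and "a > 0" and "b > 0" and "c > 0"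
    and "a + b + c = \<tau> / (2 * real n)"
    and "ccw_triangle A B C"
    and "has_angles A B C (real n * a) (real n * b) (real n * c)"
  shows "\<exists>u v w. doughnut n a b c A B C u v w"
proof -
  have sum: "real n * a + real n * b + real n * c = pi"
    using assms(1,5) by (simp add: tau_def field_simps)
  have div: "pi / real n = a + b + c" using assms(1,5) by (simp add: tau_def)
  have small: "a < pi / real n" "b < pi / real n" "c < pi / real n"
    unfolding div using assms by auto
  have full: "2 ^ n * sin_prod n x n = 2 * sin (real n * x)" "sin_prod n x n > 0"
    if "0 < x" "x < pi / real n" for x
    using sin_prod_full[of n x] sin_prod_pos[of n x n] that assms(1) by auto
  \<comment> \<open>Normalised so that the side from \<open>A\<close> to \<open>B\<close> gets the coefficient \<open>sin_prod n c n\<close>.\<close>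
  define u where "u = (B - A) / of_real (sin_prod n c n)"
  define v where "v = cis (pi - real n * b) * u"
  define w where "w = cis (pi - real n * c) * v"
  have AB: "B - A = of_real (sin_prod n c n) * u"
    using full(2)[of c] assms small by (simp add: u_def)
  have "of_real (2 * sin (real n * c)) * (C - A) =
      of_real (2 * sin (real n * b)) * cis (real n * a) * (B - A)"
    using law_of_sines[OF assms(6,7)] assms sum by simp
  then have "of_real (2 ^ n * sin_prod n c n) * (C - A) =
      of_real (2 ^ n * sin_prod n b n) * cis (real n * a) * (B - A)"
    using full(1)[of b] full(1)[of c] assms small by simp
  then have AC: "C - A = of_real (sin_prod n b n) * cis (real n * a) * u"
  proof -
    note \<open>of_real (2 ^ n * sin_prod n c n) * (C - A) = _\<close>
    also have "of_real (2 ^ n * sin_prod n b n) * cis (real n * a) * (B - A) =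
        of_real (2 ^ n * sin_prod n c n) * (of_real (sin_prod n b n) * cis (real n * a) * u)"
      unfolding AB by (simp only: of_real_mult mult_ac)
    finally show ?thesis
      using full(2)[of c] assms small unfolding mult_cancel_left by simp
  qed
  have scaled: "sin_prod n x n = 2 / 2 ^ n * sin (real n * x)" if "0 < x" "x < pi / real n" for x
    using full(1)[OF that] by (simp add: field_simps)
  \<comment> \<open>The third side comes from the closing identity of a triangle with angles \<open>n a\<close>, \<open>n b\<close>, \<open>n c\<close>.\<close>
  have "of_real (sin_prod n b n) * cis (real n * a) - of_real (sin_prod n c n)
      = of_real (2 / 2 ^ n) *
        (of_real (sin (real n * b)) * cis (real n * a) - of_real (sin (real n * a + real n * b)))"
  proof -
    have "real n * c = pi - (real n * a + real n * b)" using sum by simp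
    then have "sin (real n * c) = sin (real n * a + real n * b)" by simp
    then show ?thesis
      using scaled[of b] scaled[of c] assms small by (simp add: right_diff_distrib)
  qed
  also have "\<dots> = of_real (sin_prod n a n) * cis (pi - real n * b)"
    unfolding sin_cis_identity using scaled[of a] assms small by simp
  finally have "of_real (sin_prod n b n) * cis (real n * a) * u - of_real (sin_prod n c n) * u
      = of_real (sin_prod n a n) * v"
    unfolding v_def by (metis left_diff_distrib mult.assoc)
  then have BC: "C = B + of_real (sin_prod n a n) * v"
    using AB AC by (simp add: algebra_simps)
  have w: "cis (real n * a) * u = - w"
  proof -
    have "pi - real n * c + (pi - real n * b) = real n * a + pi" using sum by simp
    then have "w = cis (real n * a + pi) * u"
      by (simp only: w_def v_def cis_mult flip: mult.assoc)
    then show ?thesis by (simp add: cis_add_pi)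
  qed
  have "doughnut n a b c A B C u v w"
  proof
    have "B \<noteq> A" using assms(6) by (auto simp: ccw_triangle_def)
    then show "u \<noteq> 0" using AB by auto
    have "cis (pi - real n * a) * w = cis (- (real n * a)) * (cis (real n * a) * u)"
      unfolding w by (simp add: cis_add_pi)
    then show "u = cis (pi - real n * a) * w" by (simp add: cis_mult flip: mult.assoc)
    show "A = C + of_real (sin_prod n b n) * w"
      using AC unfolding mult.assoc w by (simp add: algebra_simps)
    show "B = A + of_real (sin_prod n c n) * u" using AB by (simp add: algebra_simps)
  qed (use assms sum BC v_def w_def in auto)
  then show ?thesis by blast
qed

theorem theorem5:
  fixes n :: nat and a b c :: real and A B C :: complex
  assumes "n \<ge> 2"
    and "a > 0" and "b > 0" and "c > 0"
    and "a + b + c = \<tau> / (2 * real n)"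
    and "ccw_triangle A B C"
    and "has_angles A B C (real n * a) (real n * b) (real n * c)"
  shows "\<exists>P Q R :: nat \<Rightarrow> complex. conway_doughnut n a b c A B C P Q R"
  using doughnut_frame_exists[OF assms] doughnut.is_conway_doughnut by blast

end
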